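(* Let $m,n\ge1$ and let $S\subseteq[m]\times[n]$ be a pattern of specified entries. Then the set of partial matrices subordinate to $S$ which can be completed to a rank-one matrix in $\Delta^{mn-1}$ is $$\bigcup_{I\subsetneq[m],\;J\subsetneq[n]}X(I,J;S).$$
   Context: $[m]=\{1,\dots,m\}$. A partial matrix subordinate to a pattern $S\subseteq[m]\times[n]$ is an $m\times n$ matrix in which exactly the entries in positions $S$ are specified, i.e. a point $(m_{ij})_{(i,j)\in S}$ of $\mathbb{R}^S$. $\Delta^{mn-1}$ is the standard simplex of real $m\times n$ matrices with nonnegative entries summing to one. A completion fills in the unspecified entries. Definition of $X(I,J;S)$: for $I\subseteq[m]$, $J\subseteq[n]$, it is the set of $(m_{ij})\in\mathbb{R}^S$ such that (i) for $(i,j)\in S$, $m_{ij}=0$ if and only if $i\in I$ or $j\in J$; and (ii) with $R=[m]\setminus I$, $C=[n]\setminus J$ and $S'=S\cap(R\times C)$, the restricted partial matrix $(m_{ij})_{(i,j)\in S'}$, with row set $R$ and column set $C$, satisfies the following conditions. Let $G(S')$ be the bipartite graph with vertex classes $R$ and $C$ and edge set $S'$, the edge $(i,j)$ having weight $m_{ij}$. Its transitive closure $\overline{G(S')}$ is obtained by replacing each connected component by the complete bipartite graph on the vertices of that component. Let $s$ be the number of connected components of $G(S')$ containing at least one edge and let $K_1,\dots,K_s$ be the corresponding blocks of $\overline{G(S')}$. The conditions are: - $m_{ij}>0$ for all $(i,j)\in S'$; - for every cycle $\{(r_1,c_1),(r_1,c_2),(r_2,c_2),\dots,(r_k,c_k),(r_k,c_1)\}$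 in $G(S')$ ($k\ge2$, distinct rows $r_1,\dots,r_k$ and distinct columns $c_1,\dots,c_k$), $m_{r_1c_1}m_{r_2c_2}\cdots m_{r_kc_k}=m_{r_1c_2}m_{r_2c_3}\cdots m_{r_{k-1}c_k}m_{r_kc_1}$; - if $\overline{G(S')}$ is the complete bipartite graph on $R$ and $C$, then $b_1=1$; otherwise $\sum_{l=1}^s\sqrt{b_l}\le1$. Here $b_l$ is the sum of the weights of the edges of $K_l$, where for an edge $(i,j)$ of $\overline{G(S')}$ not in $S'$ one chooses a cycle $\{(r_1,c_1),(r_1,c_2),(r_2,c_2),\dots,(r_k,c_k),(r_k,c_1)\}$ ($k\ge2$, distinct rows $r_1,\dots,r_k$ and distinct columns $c_1,\dots,c_k$) in the bipartite graph $G(S'\cup\{(i,j)\})$ with vertex classes $R$ and $C$ and edge set $S'\cup\{(i,j)\}$, with $(r_1,c_1)=(i,j)$, and sets $m_{ij}=\dfrac{m_{r_1c_2}m_{r_2c_3}\cdots m_{r_kc_1}}{m_{r_2c_2}m_{r_3c_3}\cdots m_{r_kc_k}}$ (independent of the chosen cycle when the positivity condition $m_{ij}>0$ on $S'$ and the product condition on all cycles in $G(S')$ hold). *)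

theory Defs
  imports "HOL-Analysis.Analysis" "HOL-Library.FuncSet"
begin

text \<open>
  Row and column index sets are finite (hence nonempty) types. A partial matrix
  subordinate to \<open>S\<close>, i.e. a point of $R^S$, is a function in \<open>extensional S\<close>.
\<close>

definition simplex_matrices :: "(real ^ 'n ^ 'm) set" where
  "simplex_matrices =
     {A. (\<forall>i j. 0 \<le> A $ i $ j) \<and> (\<Sum>i\<in>UNIV. \<Sum>j\<in>UNIV. A $ i $ j) = 1}"

definition is_completion ::
    "('m \<times> 'n) set \<Rightarrow> ('m \<times> 'n \<Rightarrow> real) \<Rightarrow> real ^ 'n ^ 'm \<Rightarrow> bool" where
  "is_completion S w A \<longleftrightarrow> (\<forall>(i, j)\<in>S. A $ i $ j = w (i, j))"

text \<open>
  The bipartite graph with vertex classes \<open>R\<close>, \<open>C\<close> and edge set \<open>E \<subseteq> R \<times> C\<close>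
  has the disjoint union \<open>R <+> C\<close> as its vertex set.
\<close>

definition bip_adj :: "('m \<times> 'n) set \<Rightarrow> (('m + 'n) \<times> ('m + 'n)) set" where
  "bip_adj E = {(Inl i, Inr j) | i j. (i, j) \<in> E} \<union> {(Inr j, Inl i) | i j. (i, j) \<in> E}"

definition bip_components ::
    "'m set \<Rightarrow> 'n set \<Rightarrow> ('m \<times> 'n) set \<Rightarrow> ('m + 'n) set set" where
  "bip_components R C E =
     (R <+> C) // ((bip_adj E)\<^sup>* \<inter> (R <+> C) \<times> (R <+> C))"

definition complete_bip_edges :: "('m + 'n) set \<Rightarrow> ('m \<times> 'n) set" where
  "complete_bip_edges K = {(i, j). Inl i \<in> K \<and> Inr j \<in> K}"

definition bip_closure ::
    "'m set \<Rightarrow> 'n set \<Rightarrow> ('m \<times> 'n) set \<Rightarrow> ('m \<times> 'n) set" where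
  "bip_closure R C E = (\<Union>K\<in>bip_components R C E. complete_bip_edges K)"

text \<open>The vertex sets of the components with at least one edge, i.e. of $K_1, ..., K_s$.\<close>

definition bip_blocks ::
    "'m set \<Rightarrow> 'n set \<Rightarrow> ('m \<times> 'n) set \<Rightarrow> ('m + 'n) set set" where
  "bip_blocks R C E = {K \<in> bip_components R C E. E \<inter> complete_bip_edges K \<noteq> {}}"

text \<open>
  The cycle $(r_1,c_1),(r_1,c_2),(r_2,c_2),...,(r_k,c_k),(r_k,c_1)$ is given by its
  rows and columns; indices are shifted by one and taken modulo $k$.
\<close>

definition bip_cycle :: "('m \<times> 'n) set \<Rightarrow> 'm list \<Rightarrow> 'n list \<Rightarrow> bool" where
  "bip_cycle E rs cs \<longleftrightarrow>
     length rs = length cs \<and> 2 \<le> length rs \<and> distinct rs \<and> distinct cs \<and>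
     (\<forall>l<length rs. (rs ! l, cs ! l) \<in> E \<and> (rs ! l, cs ! (Suc l mod length cs)) \<in> E)"

definition cycle_condition ::
    "('m \<times> 'n) set \<Rightarrow> ('m \<times> 'n \<Rightarrow> real) \<Rightarrow> bool" where
  "cycle_condition E w \<longleftrightarrow>
     (\<forall>rs cs. bip_cycle E rs cs \<longrightarrow>
        (\<Prod>l<length rs. w (rs ! l, cs ! l)) =
        (\<Prod>l<length rs. w (rs ! l, cs ! (Suc l mod length cs))))"

text \<open>
  Only the first edge of the chosen cycle can be the new edge \<open>e\<close>, and it is not
  used on the right-hand side: the denominator starts at index \<open>1\<close>.
\<close>

definition closure_weight ::
    "('m \<times> 'n) set \<Rightarrow> ('m \<times> 'n \<Rightarrow> real) \<Rightarrow> 'm \<times> 'n \<Rightarrow> real" where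
  "closure_weight E w e =
     (if e \<in> E then w e
      else let (rs, cs) = (SOME (rs, cs). bip_cycle (insert e E) rs cs \<and> (rs ! 0, cs ! 0) = e)
           in (\<Prod>l<length rs. w (rs ! l, cs ! (Suc l mod length cs))) /
              (\<Prod>l=1..<length rs. w (rs ! l, cs ! l)))"

definition block_sum ::
    "('m \<times> 'n) set \<Rightarrow> ('m \<times> 'n \<Rightarrow> real) \<Rightarrow> ('m + 'n) set \<Rightarrow> real" where
  "block_sum E w K = (\<Sum>e\<in>complete_bip_edges K. closure_weight E w e)"

text \<open>
  If \<open>R\<close> and \<open>C\<close> are nonempty and the closure is complete, there is exactly one block.
\<close>

definition positive_conditions ::
    "'m set \<Rightarrow> 'n set \<Rightarrow> ('m \<times> 'n) set \<Rightarrow> ('m \<times> 'n \<Rightarrow> real) \<Rightarrow> bool" where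
  "positive_conditions R C E w \<longleftrightarrow>
     (\<forall>e\<in>E. w e > 0) \<and>
     cycle_condition E w \<and>
     (if bip_closure R C E = R \<times> C
      then \<exists>K. bip_blocks R C E = {K} \<and> block_sum E w K = 1
      else (\<Sum>K\<in>bip_blocks R C E. sqrt (block_sum E w K)) \<le> 1)"

definition X_set ::
    "'m set \<Rightarrow> 'n set \<Rightarrow> ('m \<times> 'n) set \<Rightarrow> ('m \<times> 'n \<Rightarrow> real) set" where
  "X_set I J S =
     {w \<in> extensional S.
        (\<forall>(i, j)\<in>S. w (i, j) = 0 \<longleftrightarrow> i \<in> I \<or> j \<in> J) \<and>
        (let R = - I; C = - J; S' = S \<inter> (R \<times> C)
         in positive_conditions R C S' (restrict w S'))}"

end

theory Submission
  imports Defs "HOL-Library.Transitive_Closure_Table"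
begin

text \<open>
  A rank-one matrix in the simplex is an outer product of two nonnegative vectors \<open>x\<close> and
  \<open>y\<close> with entry sum one, and \<open>I\<close> and \<open>J\<close> are index sets on which these
  vectors vanish. On the other rows and columns the question is whether weights on the edges of a bipartite
  graph come from vertex potentials, \<open>w (i, j) = x i * y j\<close>, of total mass \<open>sum x * sum y =
  1\<close>.

  For positive weights, positive potentials exist if and only if the two products around every cycle agree
  (\<open>factorization_imp_cycle_condition\<close>, \<open>cycle_condition_imp_factorization\<close>). On a
  connected component they are unique up to multiplying the rows and dividing the columns by a common factor, so
  the products \<open>x i * y j\<close> inside a component are determined: they are the weights of the closure,
  and the weight of a block is its row mass times its column mass (\<open>closure_weight_eq\<close>,
  \<open>block_sum_eq\<close>).

  If the graph is connected nothing is left to choose, and the single block must have weight one. Otherwise the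
  factors of the components can be chosen freely. Normalizing \<open>x\<close> and \<open>y\<close> to have sum
  one, the arithmetic-geometric mean inequality in each block bounds the sum of the square roots of the block
  weights by one (\<open>factorization_imp_positive_conditions\<close>). Conversely, this sum is the least
  possible value of \<open>sqrt (sum x * sum y)\<close>, reached by making the row mass and the column mass of
  each block equal and giving isolated vertices none; from a value at most one the total can be raised to
  exactly one by unbalancing a component (\<open>balanced_factorization\<close>).
\<close>

section \<open>Rank-one matrices in the simplex\<close>

text \<open>
  Row sums and column sums serve as the factors: if the entries are \<open>c i * b j\<close>, then the product
  of a row sum and a column sum is the entry times the total, which is one.
\<close>
lemma rank_one_simplex_factors:
  fixes A :: "real ^ 'n::finite ^ 'm::finite"
  assumes "A \<in> simplex_matrices" "rank A = 1"
  obtains x y where "\<forall>i. 0 \<le> x i" "\<forall>j. 0 \<le> y j" "sum x UNIV = 1" "sum y UNIV = 1"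
    "\<forall>i j. A $ i $ j = x i * y j"
proof -
  have nonneg: "0 \<le> A $ i $ j" and total: "(\<Sum>i\<in>UNIV. \<Sum>j\<in>UNIV. A $ i $ j) = 1" for i j
    using assms(1) by (auto simp: simplex_matrices_def)
  obtain B where B: "B \<subseteq> rows A" "rows A \<subseteq> span B" "card B = dim (rows A)"
    using basis_exists[of "rows A"] by metis
  then obtain b where b: "B = {b}"
    using assms(2) by (metis card_1_singletonE row_rank_def)
  have "\<exists>c. row i A = c *\<^sub>R b" for i
    using B(2) b by (auto simp: rows_def span_singleton)
  then obtain c where c: "\<And>i. row i A = c i *\<^sub>R b"
    by metis
  have entry: "A $ i $ j = c i * b $ j" for i j
    using arg_cong[OF c[of i], of "\<lambda>r. r $ j"] by (simp add: row_def)
  define x where "x = (\<lambda>i. \<Sum>j\<in>UNIV. A $ i $ j)"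
  define y where "y = (\<lambda>j. \<Sum>i\<in>UNIV. A $ i $ j)"
  have x: "x i = c i * (\<Sum>j\<in>UNIV. b $ j)" for i
    by (simp add: x_def entry sum_distrib_left)
  have y: "y j = (\<Sum>i\<in>UNIV. c i) * b $ j" for j
    by (simp add: y_def entry sum_distrib_right)
  have one: "(\<Sum>i\<in>UNIV. c i) * (\<Sum>j\<in>UNIV. b $ j) = 1"
    using total by (simp add: entry sum_product)
  have prod: "x i * y j = A $ i $ j" for i j
  proof -
    have "x i * y j = c i * b $ j * ((\<Sum>i\<in>UNIV. c i) * (\<Sum>j\<in>UNIV. b $ j))"
      by (simp only: x y mult_ac)
    then show ?thesis using one entry by simp
  qed
  show thesis
  proof (rule that)
    show "sum x UNIV = 1" using total by (simp add: x_def)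
    show "sum y UNIV = 1" using total unfolding y_def by (subst sum.swap) simp
  qed (simp_all add: prod, auto simp: x_def y_def nonneg intro: sum_nonneg)
qed

lemma outer_product_rank_one_simplex:
  fixes x :: "'m::finite \<Rightarrow> real" and y :: "'n::finite \<Rightarrow> real"
  assumes "\<And>i. 0 \<le> x i" "\<And>j. 0 \<le> y j" "sum x UNIV * sum y UNIV = 1"
  defines "A \<equiv> (\<chi> i j. x i * y j) :: real ^ 'n ^ 'm"
  shows "A \<in> simplex_matrices" "rank A = 1"
proof -
  have total: "(\<Sum>i\<in>UNIV. \<Sum>j\<in>UNIV. A $ i $ j) = 1"
    using assms(3) by (simp add: A_def sum_product)
  then show "A \<in> simplex_matrices"
    using assms(1,2) by (simp add: simplex_matrices_def A_def)
  have "row i A = x i *\<^sub>R (\<chi> j. y j)" for i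
    by (simp add: row_def A_def vec_eq_iff)
  then have "rows A \<subseteq> span {\<chi> j. y j}"
    by (auto simp: rows_def span_singleton)
  then have "rank A \<le> 1"
    unfolding row_rank_def using dim_le_card[of "rows A" "{\<chi> j. y j}"] by simp
  moreover have "A \<noteq> 0" using total by auto
  then have "rank A \<noteq> 0" by (simp add: rank_eq_0)
  ultimately show "rank A = 1" by linarith
qed

section \<open>Cycles and factorizations\<close>

lemma prod_cyclic_shift:
  fixes f :: "nat \<Rightarrow> 'a::comm_monoid_mult"
  shows "(\<Prod>l<k. f (Suc l mod k)) = (\<Prod>l<k. f l)"
proof (cases k)
  case (Suc k')
  have "(\<Prod>l<Suc k'. f (Suc l mod Suc k')) = (\<Prod>l<k'. f (Suc l)) * f 0"
    by (simp add: prod.lessThan_Suc)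
  also have "\<dots> = (\<Prod>l<Suc k'. f l)"
    by (simp only: prod.lessThan_Suc_shift mult.commute)
  finally show ?thesis using Suc by simp
qed simp

lemma cycle_products_factor:
  fixes u :: "'m \<Rightarrow> real" and v :: "'n \<Rightarrow> real"
  assumes "length rs = length cs"
  shows "(\<Prod>l<length rs. u (rs ! l) * v (cs ! l)) =
         (\<Prod>l<length rs. u (rs ! l) * v (cs ! (Suc l mod length cs)))"
  using prod_cyclic_shift[of "\<lambda>l. v (cs ! l)" "length cs"] assms
  by (simp add: prod.distrib)

lemma factorization_imp_cycle_condition:
  assumes "\<And>i j. (i, j) \<in> E \<Longrightarrow> w (i, j) = u i * v j"
  shows "cycle_condition E w"
  unfolding cycle_condition_def
proof (intro allI impI)
  fix rs cs assume cyc: "bip_cycle E rs cs"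
  have "(\<Prod>l<length rs. w (rs ! l, cs ! l)) = (\<Prod>l<length rs. u (rs ! l) * v (cs ! l))"
    using cyc by (intro prod.cong) (auto simp: bip_cycle_def assms)
  also have "\<dots> = (\<Prod>l<length rs. u (rs ! l) * v (cs ! (Suc l mod length cs)))"
    using cyc by (intro cycle_products_factor) (simp add: bip_cycle_def)
  also have "\<dots> = (\<Prod>l<length rs. w (rs ! l, cs ! (Suc l mod length cs)))"
    using cyc by (intro prod.cong) (auto simp: bip_cycle_def assms)
  finally show "(\<Prod>l<length rs. w (rs ! l, cs ! l)) =
    (\<Prod>l<length rs. w (rs ! l, cs ! (Suc l mod length cs)))" .
qed

text \<open>
  Rows and columns of a cycle are distinct, so the new edge occurs in the cycle only once, and all
  other edges are old ones.
\<close>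
lemma bip_cycle_insert_edges:
  assumes "bip_cycle (insert (i, j) E) rs cs" "rs ! 0 = i" "cs ! 0 = j" "l < length rs"
  shows "(rs ! l, cs ! (Suc l mod length cs)) \<in> E" and "0 < l \<Longrightarrow> (rs ! l, cs ! l) \<in> E"
proof -
  note cyc = assms(1)[unfolded bip_cycle_def]
  have len: "length cs = length rs" "2 \<le> length rs" and d: "distinct rs" "distinct cs"
    using cyc by auto
  have l0: "l = 0" if "rs ! l = i"
    using that assms(2,4) d(1) len by (metis nth_eq_iff_index_eq zero_less_iff_neq_zero not_less_zero)
  have "cs ! (Suc l mod length cs) \<noteq> j" if "l = 0"
  proof -
    have "1 < length cs" "0 < length cs" using len by auto
    then have "cs ! 1 \<noteq> cs ! 0" using nth_eq_iff_index_eq[OF d(2), of 1 0] by simp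
    then show ?thesis using that assms(3) \<open>1 < length cs\<close> by simp
  qed
  then show "(rs ! l, cs ! (Suc l mod length cs)) \<in> E"
    using cyc assms(4) l0 by auto
  show "(rs ! l, cs ! l) \<in> E" if "0 < l"
    using cyc assms(4) l0 that by auto
qed

text \<open>
  In the quotient of the two products of a cycle through \<open>(i, j)\<close> every potential cancels
  except those of \<open>i\<close> and \<open>j\<close>.
\<close>
lemma cycle_quotient_eq:
  fixes u :: "'m \<Rightarrow> real" and v :: "'n \<Rightarrow> real"
  assumes cyc: "bip_cycle (insert (i, j) E) rs cs" "rs ! 0 = i" "cs ! 0 = j"
    and w: "\<And>i j. (i, j) \<in> E \<Longrightarrow> w (i, j) = u i * v j"
    and nz: "\<And>e. e \<in> E \<Longrightarrow> w e \<noteq> 0"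
  shows "(\<Prod>l<length rs. w (rs ! l, cs ! (Suc l mod length cs))) /
         (\<Prod>l=1..<length rs. w (rs ! l, cs ! l)) = u i * v j"
proof -
  have len: "length rs = length cs" "0 < length rs"
    using cyc(1) by (auto simp: bip_cycle_def)
  have edge: "(rs ! l, cs ! l) \<in> E" if "l \<in> {1..<length rs}" for l
    using bip_cycle_insert_edges(2)[OF cyc] that by auto
  have "(\<Prod>l<length rs. w (rs ! l, cs ! (Suc l mod length cs))) =
        (\<Prod>l<length rs. u (rs ! l) * v (cs ! (Suc l mod length cs)))"
    using bip_cycle_insert_edges(1)[OF cyc] by (intro prod.cong) (auto simp: w)
  also have "\<dots> = (\<Prod>l<length rs. u (rs ! l) * v (cs ! l))"
    by (rule cycle_products_factor[symmetric]) (rule len(1))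
  also have "\<dots> = u i * v j * (\<Prod>l=1..<length rs. u (rs ! l) * v (cs ! l))"
    using len(2) cyc(2,3) by (simp add: lessThan_atLeast0 prod.atLeast_Suc_lessThan)
  also have "(\<Prod>l=1..<length rs. u (rs ! l) * v (cs ! l)) = (\<Prod>l=1..<length rs. w (rs ! l, cs ! l))"
    using edge by (intro prod.cong) (auto simp: w)
  finally show ?thesis
    using edge nz by simp
qed

lemma sym_bip_adj: "sym (bip_adj E)"
  by (auto simp: sym_def bip_adj_def)

lemma bip_adj_rtrancl_sym: "(a, b) \<in> (bip_adj E)\<^sup>* \<Longrightarrow> (b, a) \<in> (bip_adj E)\<^sup>*"
  by (meson sym_bip_adj sym_rtrancl symD)

text \<open>
  A walk between the ends of a missing edge contains a path without repeated vertices. The path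
  alternates between rows (even positions) and columns (odd positions), and the missing edge
  closes it to a cycle of length at least four.
\<close>
lemma connected_imp_bip_cycle:
  assumes conn: "(Inl i, Inr j) \<in> (bip_adj E)\<^sup>*" and new: "(i, j) \<notin> E"
  obtains rs cs where "bip_cycle (insert (i, j) E) rs cs" "rs ! 0 = i" "cs ! 0 = j"
proof -
  let ?r = "\<lambda>a b. (a, b) \<in> bip_adj E"
  have "?r\<^sup>*\<^sup>* (Inl i) (Inr j)"
    using conn by (simp add: rtranclp_rtrancl_eq)
  then obtain zs where zs: "rtrancl_path ?r (Inl i) zs (Inr j)" "distinct (Inl i # zs)"
    by (metis rtranclp_eq_rtrancl_path rtrancl_path_distinct)
  define p where "p = Inl i # zs"
  have ne: "zs \<noteq> []" using zs(1) by (auto elim: rtrancl_path.cases)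
  have dp: "distinct p" using zs(2) by (simp add: p_def)
  have p0: "p ! 0 = Inl i" by (simp add: p_def)
  have step: "(p ! t, p ! Suc t) \<in> bip_adj E" if "Suc t < length p" for t
    using rtrancl_path_nth[OF zs(1), of t] that by (simp add: p_def)
  have plast: "p ! (length p - 1) = Inr j"
    using rtrancl_path_last[OF zs(1) ne] ne by (simp add: p_def last_conv_nth nth_Cons')
  have parity: "isl (p ! t) \<longleftrightarrow> even t" if "t < length p" for t
    using that
  proof (induction t)
    case 0 then show ?case by (simp add: p0)
  next
    case (Suc t)
    then show ?case using step[of t] by (auto simp: bip_adj_def)
  qed
  have "odd (length p - 1)"
    using parity[of "length p - 1"] plast by (simp add: p_def)
  then obtain k where k: "length p = 2 * k" "0 < k"
    by (metis One_nat_def Suc_pred even_Suc evenE gr0I length_greater_0_conv list.distinct(1)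
        mult_0_right p_def)
  \<comment> \<open>Column \<open>l\<close> of the cycle precedes row \<open>l\<close> on the path; column \<open>0\<close> is its last vertex.\<close>
  define q where "q = (\<lambda>l. if l = 0 then 2 * k - 1 else 2 * l - 1 :: nat)"
  define rs where "rs = map (\<lambda>l. projl (p ! (2 * l))) [0..<k]"
  define cs where "cs = map (\<lambda>l. projr (p ! q l)) [0..<k]"
  have row: "p ! (2 * l) = Inl (rs ! l)" if "l < k" for l
    using parity[of "2 * l"] that k by (auto simp: rs_def)
  have qlt: "q l < 2 * k" and qodd: "odd (q l)" if "l < k" for l
    using that by (auto simp: q_def)
  have col: "p ! q l = Inr (cs ! l)" if "l < k" for l
    using parity[of "q l"] that k qlt[OF that] qodd[OF that] by (cases "p ! q l") (auto simp: cs_def)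
  have q_shift: "q (Suc l mod k) = Suc (2 * l)" if "l < k" for l
  proof (cases "Suc l = k")
    case True then show ?thesis by (auto simp: q_def)
  next
    case False then show ?thesis using that by (auto simp: q_def)
  qed
  have len: "length rs = k" "length cs = k"
    by (auto simp: rs_def cs_def)
  have r0: "rs ! 0 = i" using row[of 0] k p0 by simp
  have c0: "cs ! 0 = j" using col[of 0] k plast by (simp add: q_def)
  have q_inj: "q l = q l' \<longleftrightarrow> l = l'" if "l < k" "l' < k" for l l'
    using that by (auto simp: q_def)
  have "distinct rs"
    unfolding distinct_conv_nth len
  proof (intro allI impI)
    fix a b assume ab: "a < k" "b < k" "a \<noteq> b"
    then have "p ! (2 * a) \<noteq> p ! (2 * b)"
      using dp k by (simp add: nth_eq_iff_index_eq)
    then show "rs ! a \<noteq> rs ! b" using row ab by auto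
  qed
  moreover have "distinct cs"
    unfolding distinct_conv_nth len
  proof (intro allI impI)
    fix a b assume ab: "a < k" "b < k" "a \<noteq> b"
    then have "p ! q a \<noteq> p ! q b"
      using dp k qlt q_inj by (simp add: nth_eq_iff_index_eq)
    then show "cs ! a \<noteq> cs ! b" using col ab by auto
  qed
  moreover have forward: "(rs ! l, cs ! (Suc l mod k)) \<in> E" if "l < k" for l
  proof -
    have "Suc l mod k < k" using k by simp
    from col[OF this] have "p ! Suc (2 * l) = Inr (cs ! (Suc l mod k))"
      using q_shift[OF that] by simp
    then show ?thesis
      using step[of "2 * l"] row[OF that] that k by (auto simp: bip_adj_def)
  qed
  moreover have "(rs ! l, cs ! l) \<in> insert (i, j) E" if "l < k" for l
  proof (cases "l = 0")
    case False
    then have "Suc (q l) = 2 * l" by (simp add: q_def)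
    then have "(Inr (cs ! l), Inl (rs ! l)) \<in> bip_adj E"
      using step[of "q l"] row[OF that] col[OF that] that k by auto
    then show ?thesis by (auto simp: bip_adj_def)
  qed (simp add: r0 c0)
  moreover have "2 \<le> k"
  proof (rule ccontr)
    assume "\<not> 2 \<le> k"
    then have "k = 1" using k by simp
    then show False using forward[of 0] r0 c0 new by simp
  qed
  ultimately have "bip_cycle (insert (i, j) E) rs cs"
    by (auto simp: bip_cycle_def len)
  then show thesis using that r0 c0 by blast
qed

lemma cycle_condition_mono: "cycle_condition E w \<Longrightarrow> E' \<subseteq> E \<Longrightarrow> cycle_condition E' w"
  unfolding cycle_condition_def bip_cycle_def by blast

text \<open>
  Insert the edges one at a time. An edge between two components is accommodated by rescaling
  one of them; an edge inside a component closes a cycle, whose condition prescribes its weight.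
\<close>
lemma cycle_condition_imp_factorization:
  fixes w :: "'m \<times> 'n \<Rightarrow> real"
  assumes "finite E" "\<And>e. e \<in> E \<Longrightarrow> 0 < w e" "cycle_condition E w"
  shows "\<exists>u v. (\<forall>i. 0 < u i) \<and> (\<forall>j. 0 < v j) \<and> (\<forall>i j. (i, j) \<in> E \<longrightarrow> w (i, j) = u i * v j)"
  using assms
proof (induction E rule: finite_induct)
  case empty
  show ?case by (rule exI[of _ "\<lambda>_. 1"], rule exI[of _ "\<lambda>_. 1"]) simp
next
  case (insert e E)
  obtain i j where e: "e = (i, j)" by (cases e)
  have "cycle_condition E w"
    using insert.prems(2) by (rule cycle_condition_mono) auto
  then obtain u v where u: "\<And>i. 0 < u i" and v: "\<And>j. 0 < v j"
    and w: "\<And>i j. (i, j) \<in> E \<Longrightarrow> w (i, j) = u i * v j"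
    using insert by (metis insertCI)
  have pos: "0 < w (i, j)" using insert.prems(1) e by simp
  have w_nz: "w e' \<noteq> 0" if "e' \<in> E" for e' using insert.prems(1)[of e'] that by simp
  show ?case
  proof (cases "(Inl i, Inr j) \<in> (bip_adj E)\<^sup>*")
    case True
    then obtain rs cs where cyc: "bip_cycle (insert (i, j) E) rs cs" "rs ! 0 = i" "cs ! 0 = j"
      using insert.hyps(2) e connected_imp_bip_cycle by metis
    have len: "0 < length rs" using cyc(1) by (auto simp: bip_cycle_def)
    have nz: "(\<Prod>l=1..<length rs. w (rs ! l, cs ! l)) \<noteq> 0"
    proof -
      have "w (rs ! l, cs ! l) \<noteq> 0" if "l \<in> {1..<length rs}" for l
      proof -
        have "(rs ! l, cs ! l) \<in> E" using bip_cycle_insert_edges(2)[OF cyc, of l] that by simp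
        then show ?thesis using w_nz by blast
      qed
      then show ?thesis by simp
    qed
    let ?p = "\<Prod>l<length rs. w (rs ! l, cs ! (Suc l mod length cs))"
    have quot: "?p / (\<Prod>l=1..<length rs. w (rs ! l, cs ! l)) = u i * v j"
      by (rule cycle_quotient_eq[where u=u and v=v and w=w, OF cyc w w_nz])
    have "w (i, j) * (\<Prod>l=1..<length rs. w (rs ! l, cs ! l)) = (\<Prod>l<length rs. w (rs ! l, cs ! l))"
      using len cyc(2,3) by (simp add: lessThan_atLeast0 prod.atLeast_Suc_lessThan)
    also have "\<dots> = (\<Prod>l<length rs. w (rs ! l, cs ! (Suc l mod length cs)))"
      using insert.prems(2) cyc(1) e by (simp add: cycle_condition_def)
    finally have "w (i, j) = u i * v j"
      using quot nz by (simp add: nonzero_divide_eq_eq)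
    then show ?thesis using u v w e by blast
  next
    case False
    define D where "D = (bip_adj E)\<^sup>* `` {Inl i}"
    \<comment> \<open>Only the row end of the new edge lies in \<open>D\<close>, so its product is multiplied by \<open>s\<close>.\<close>
    define s where "s = w (i, j) / (u i * v j)"
    define u' where "u' = (\<lambda>a. if Inl a \<in> D then s * u a else u a)"
    define v' where "v' = (\<lambda>b. if Inr b \<in> D then v b / s else v b)"
    have s: "0 < s" using pos u v by (simp add: s_def)
    have D_edge: "Inl a \<in> D \<longleftrightarrow> Inr b \<in> D" if "(a, b) \<in> E" for a b
    proof -
      have "(Inl a, Inr b) \<in> bip_adj E" "(Inr b, Inl a) \<in> bip_adj E"
        using that by (auto simp: bip_adj_def)
      then show ?thesis unfolding D_def by (auto intro: rtrancl_into_rtrancl)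
    qed
    have "u' a * v' b = w (a, b)" if "(a, b) \<in> insert e E" for a b
    proof (cases "(a, b) = e")
      case True
      have "Inl i \<in> D" "Inr j \<notin> D" using False by (auto simp: D_def)
      then show ?thesis using True e u[of i] v[of j] by (simp add: u'_def v'_def s_def)
    next
      case False
      then have "(a, b) \<in> E" using that by simp
      then show ?thesis using D_edge[of a b] w[of a b] s by (simp add: u'_def v'_def)
    qed
    moreover have "0 < u' a" "0 < v' b" for a b
      using u v s by (auto simp: u'_def v'_def)
    ultimately show ?thesis by metis
  qed
qed

section \<open>Components, blocks and their weights\<close>

lemma bip_component_equiv:
  "equiv (R <+> C) ((bip_adj E)\<^sup>* \<inter> (R <+> C) \<times> (R <+> C))"
proof (rule equivI)
  show "sym ((bip_adj E)\<^sup>* \<inter> (R <+> C) \<times> (R <+> C))"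
    by (auto intro!: symI bip_adj_rtrancl_sym)
  show "trans ((bip_adj E)\<^sup>* \<inter> (R <+> C) \<times> (R <+> C))"
    by (auto intro!: transI intro: rtrancl_trans)
qed (auto simp: refl_on_def)

lemma bip_components_subset: "K \<in> bip_components R C E \<Longrightarrow> K \<subseteq> R <+> C"
  using in_quotient_imp_subset[OF bip_component_equiv] unfolding bip_components_def by blast

lemma bip_component_connected:
  "K \<in> bip_components R C E \<Longrightarrow> a \<in> K \<Longrightarrow> b \<in> K \<Longrightarrow> (a, b) \<in> (bip_adj E)\<^sup>*"
  using in_quotient_imp_in_rel[OF bip_component_equiv, of K R C E a b]
  unfolding bip_components_def by blast

lemma connected_imp_bip_component:
  assumes "a \<in> R <+> C" "b \<in> R <+> C" "(a, b) \<in> (bip_adj E)\<^sup>*"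
  shows "\<exists>K\<in>bip_components R C E. a \<in> K \<and> b \<in> K"
  unfolding bip_components_def using assms
  by (intro bexI[OF _ quotientI[OF assms(1)]]) auto

lemma disjoint_bip_components: "disjoint (bip_components R C E)"
  unfolding disjoint_def bip_components_def
  using quotient_disj[OF bip_component_equiv] by blast

lemma disjoint_bip_blocks: "disjoint (bip_blocks R C E)"
  by (rule pairwise_subset[OF disjoint_bip_components]) (auto simp: bip_blocks_def)

lemma bip_closure_iff:
  "(i, j) \<in> bip_closure R C E \<longleftrightarrow> i \<in> R \<and> j \<in> C \<and> (Inl i, Inr j) \<in> (bip_adj E)\<^sup>*"
proof
  assume "(i, j) \<in> bip_closure R C E"
  then obtain K where K: "K \<in> bip_components R C E" "Inl i \<in> K" "Inr j \<in> K"
    by (auto simp: bip_closure_def complete_bip_edges_def)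
  then show "i \<in> R \<and> j \<in> C \<and> (Inl i, Inr j) \<in> (bip_adj E)\<^sup>*"
    using bip_components_subset[OF K(1)] bip_component_connected[OF K] by auto
next
  assume "i \<in> R \<and> j \<in> C \<and> (Inl i, Inr j) \<in> (bip_adj E)\<^sup>*"
  then show "(i, j) \<in> bip_closure R C E"
    using connected_imp_bip_component[of "Inl i" R C "Inr j" E]
    by (auto simp: bip_closure_def complete_bip_edges_def)
qed

lemma edge_in_bip_block:
  assumes "E \<subseteq> R \<times> C" "(i, j) \<in> E"
  shows "\<exists>K\<in>bip_blocks R C E. Inl i \<in> K \<and> Inr j \<in> K"
proof -
  have "(Inl i, Inr j) \<in> (bip_adj E)\<^sup>*"
    using assms(2) by (auto simp: bip_adj_def)
  moreover have "Inl i \<in> R <+> C" "Inr j \<in> R <+> C"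
    using assms by auto
  ultimately obtain K where K: "K \<in> bip_components R C E" "Inl i \<in> K" "Inr j \<in> K"
    using connected_imp_bip_component[of "Inl i" R C "Inr j" E] by meson
  then have "(i, j) \<in> E \<inter> complete_bip_edges K"
    using assms(2) by (simp add: complete_bip_edges_def)
  then have "K \<in> bip_blocks R C E"
    using K(1) unfolding bip_blocks_def by blast
  then show ?thesis using K(2,3) by (intro bexI conjI)
qed

text \<open>
  With both vertex classes nonempty, a complete closure makes the graph connected: two rows are
  joined through any column.
\<close>
lemma complete_closure_blocks:
  assumes "E \<subseteq> R \<times> C" "R \<noteq> {}" "C \<noteq> {}" "bip_closure R C E = R \<times> C"
  shows "bip_blocks R C E = {R <+> C}"
proof -
  have conn: "(Inl i, Inr j) \<in> (bip_adj E)\<^sup>*" if "i \<in> R" "j \<in> C" for i j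
    using that assms(4) bip_closure_iff[of i j R C E] by auto
  obtain i0 j0 where ij: "i0 \<in> R" "j0 \<in> C" using assms by auto
  have all: "(Inl i0, z) \<in> (bip_adj E)\<^sup>*" if "z \<in> R <+> C" for z
    using that
  proof (elim PlusE)
    fix i assume "i \<in> R" "z = Inl i"
    then show ?thesis
      using conn[OF ij] bip_adj_rtrancl_sym[OF conn[of i j0]] ij by auto
  qed (auto simp: conn ij)
  have whole: "K = R <+> C" if K: "K \<in> bip_components R C E" for K
  proof
    show "K \<subseteq> R <+> C" by (rule bip_components_subset[OF K])
    have "K \<noteq> {}"
      by (rule in_quotient_imp_non_empty[OF bip_component_equiv K[unfolded bip_components_def]])
    then obtain z where z: "z \<in> K" by auto
    have zRC: "z \<in> R <+> C" using z bip_components_subset[OF K] by auto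
    show "R <+> C \<subseteq> K"
    proof
      fix t assume t: "t \<in> R <+> C"
      have "(z, t) \<in> (bip_adj E)\<^sup>*"
        using all[OF t] bip_adj_rtrancl_sym[OF all[OF zRC]] by auto
      then show "t \<in> K"
        using in_quotient_imp_closed[OF bip_component_equiv K[unfolded bip_components_def] z] t zRC
        by blast
    qed
  qed
  have "bip_adj E \<noteq> {}"
    using conn[OF ij] by auto
  then obtain i j where "(i, j) \<in> E" by (auto simp: bip_adj_def)
  then obtain K where "K \<in> bip_blocks R C E" using edge_in_bip_block[OF assms(1)] by blast
  moreover have "K = R <+> C" if "K \<in> bip_blocks R C E" for K
    using that whole by (simp add: bip_blocks_def)
  ultimately show ?thesis by blast
qed

text \<open>
  A missing edge inside a component closes some cycle, and by \<open>cycle_quotient_eq\<close> every such cycle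
  yields the same weight; this makes the choice in \<open>closure_weight\<close> harmless.
\<close>
lemma closure_weight_eq:
  assumes K: "K \<in> bip_components R C E" "Inl i \<in> K" "Inr j \<in> K"
    and w: "\<And>i j. (i, j) \<in> E \<Longrightarrow> w (i, j) = u i * v j"
    and nz: "\<And>e. e \<in> E \<Longrightarrow> w e \<noteq> 0"
  shows "closure_weight E w (i, j) = u i * v j"
proof (cases "(i, j) \<in> E")
  case True then show ?thesis by (simp add: closure_weight_def w)
next
  case False
  let ?P = "\<lambda>(rs, cs). bip_cycle (insert (i, j) E) rs cs \<and> (rs ! 0, cs ! 0) = (i, j)"
  obtain rs cs where some: "(SOME p. ?P p) = (rs, cs)" by (rule prod.exhaust)
  obtain rs' cs' where "bip_cycle (insert (i, j) E) rs' cs'" "rs' ! 0 = i" "cs' ! 0 = j"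
    by (rule connected_imp_bip_cycle[OF bip_component_connected[OF K] False])
  then have "?P (rs', cs')" by simp
  then have "?P (SOME p. ?P p)" by (rule someI[of ?P])
  then have cyc: "bip_cycle (insert (i, j) E) rs cs" "rs ! 0 = i" "cs ! 0 = j"
    unfolding some by auto
  have "closure_weight E w (i, j) =
      (\<Prod>l<length rs. w (rs ! l, cs ! (Suc l mod length cs))) /
      (\<Prod>l=1..<length rs. w (rs ! l, cs ! l))"
    by (simp only: closure_weight_def False if_False some Let_def case_prod_conv)
  also have "\<dots> = u i * v j"
    by (rule cycle_quotient_eq[where u=u and v=v and w=w, OF cyc w nz])
  finally show ?thesis .
qed

lemma block_sum_eq:
  fixes R :: "'m::finite set" and C :: "'n::finite set"
  assumes K: "K \<in> bip_blocks R C E"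
    and w: "\<And>i j. (i, j) \<in> E \<Longrightarrow> w (i, j) = u i * v j"
    and nz: "\<And>e. e \<in> E \<Longrightarrow> w e \<noteq> 0"
  shows "block_sum E w K = (\<Sum>i | Inl i \<in> K. u i) * (\<Sum>j | Inr j \<in> K. v j)"
proof -
  have K': "K \<in> bip_components R C E" using K by (simp add: bip_blocks_def)
  have "block_sum E w K = (\<Sum>(i, j)\<in>complete_bip_edges K. u i * v j)"
    unfolding block_sum_def
  proof (intro sum.cong refl)
    fix e assume "e \<in> complete_bip_edges K"
    then show "closure_weight E w e = (case e of (i, j) \<Rightarrow> u i * v j)"
      using closure_weight_eq[where u=u and v=v and w=w, OF K' _ _ w nz]
      by (auto simp: complete_bip_edges_def)
  qed
  also have "complete_bip_edges K = {i. Inl i \<in> K} \<times> {j. Inr j \<in> K}"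
    by (auto simp: complete_bip_edges_def)
  finally show ?thesis
    by (simp add: sum_product sum.cartesian_product)
qed

lemma sum_over_disjoint_family:
  fixes g :: "'a::finite \<Rightarrow> real" and \<iota> :: "'a \<Rightarrow> 'v"
  assumes "finite F" "disjoint F"
  shows "(\<Sum>a | \<iota> a \<in> \<Union>F. g a) = (\<Sum>K\<in>F. \<Sum>a | \<iota> a \<in> K. g a)"
proof -
  have "{a. \<iota> a \<in> \<Union>F} = (\<Union>K\<in>F. {a. \<iota> a \<in> K})" by auto
  moreover have "sum g (\<Union>K\<in>F. {a. \<iota> a \<in> K}) = (\<Sum>K\<in>F. sum g {a. \<iota> a \<in> K})"
    using assms by (intro sum.UNION_disjoint) (auto simp: disjoint_def)
  ultimately show ?thesis by simp
qed

section \<open>From a completion to the block inequality\<close>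

text \<open>
  The inequality is the arithmetic-geometric mean inequality in each block: a block carrying row
  mass \<open>X\<close> and column mass \<open>Y\<close> has weight \<open>X * Y\<close>, and both the row masses and the column
  masses of the disjoint blocks add up to at most one.
\<close>
lemma factorization_imp_positive_conditions:
  fixes R :: "'m::finite set" and C :: "'n::finite set"
  assumes E: "E \<subseteq> R \<times> C" and R: "R \<noteq> {}" "C \<noteq> {}"
    and x: "\<And>i. 0 \<le> x i" "\<And>i. i \<in> R \<Longrightarrow> 0 < x i" "sum x UNIV = 1" "\<And>i. i \<notin> R \<Longrightarrow> x i = 0"
    and y: "\<And>j. 0 \<le> y j" "\<And>j. j \<in> C \<Longrightarrow> 0 < y j" "sum y UNIV = 1" "\<And>j. j \<notin> C \<Longrightarrow> y j = 0"
    and w: "\<And>i j. (i, j) \<in> E \<Longrightarrow> w (i, j) = x i * y j"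
  shows "positive_conditions R C E w"
proof -
  have pos: "0 < w e" if "e \<in> E" for e
    using that E x(2) y(2) w by (cases e) auto
  define X where "X = (\<lambda>K :: ('m + 'n) set. \<Sum>i | Inl i \<in> K. x i)"
  define Y where "Y = (\<lambda>K :: ('m + 'n) set. \<Sum>j | Inr j \<in> K. y j)"
  have b: "block_sum E w K = X K * Y K" if "K \<in> bip_blocks R C E" for K
    unfolding X_def Y_def using pos that w by (intro block_sum_eq) (auto simp: less_le)
  have complete: "\<exists>K. bip_blocks R C E = {K} \<and> block_sum E w K = 1"
    if "bip_closure R C E = R \<times> C"
  proof (intro exI conjI)
    show blocks: "bip_blocks R C E = {R <+> C}"
      by (rule complete_closure_blocks[OF E R that])
    have "X (R <+> C) = sum x UNIV"
      unfolding X_def using x(4) by (intro sum.mono_neutral_left) auto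
    moreover have "Y (R <+> C) = sum y UNIV"
      unfolding Y_def using y(4) by (intro sum.mono_neutral_left) auto
    ultimately show "block_sum E w (R <+> C) = 1"
      using b[of "R <+> C"] blocks x(3) y(3) by simp
  qed
  have "(\<Sum>K\<in>bip_blocks R C E. sqrt (block_sum E w K)) \<le> (\<Sum>K\<in>bip_blocks R C E. (X K + Y K) / 2)"
  proof (rule sum_mono)
    fix K assume K: "K \<in> bip_blocks R C E"
    have "0 \<le> X K" "0 \<le> Y K" using x(1) y(1) by (auto simp: X_def Y_def intro: sum_nonneg)
    then show "sqrt (block_sum E w K) \<le> (X K + Y K) / 2"
      using b[OF K] arith_geo_mean_sqrt[of "X K" "Y K"] by simp
  qed
  also have "\<dots> = ((\<Sum>K\<in>bip_blocks R C E. X K) + (\<Sum>K\<in>bip_blocks R C E. Y K)) / 2"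
    by (simp add: sum.distrib flip: sum_divide_distrib)
  also have "(\<Sum>K\<in>bip_blocks R C E. X K) \<le> 1"
  proof -
    have "(\<Sum>K\<in>bip_blocks R C E. X K) = (\<Sum>i | Inl i \<in> \<Union>(bip_blocks R C E). x i)"
      unfolding X_def by (rule sum_over_disjoint_family[symmetric]) (auto simp: disjoint_bip_blocks)
    also have "\<dots> \<le> sum x UNIV" using x(1) by (intro sum_mono2) auto
    finally show ?thesis using x(3) by simp
  qed
  also have "(\<Sum>K\<in>bip_blocks R C E. Y K) \<le> 1"
  proof -
    have "(\<Sum>K\<in>bip_blocks R C E. Y K) = (\<Sum>j | Inr j \<in> \<Union>(bip_blocks R C E). y j)"
      unfolding Y_def by (rule sum_over_disjoint_family[symmetric]) (auto simp: disjoint_bip_blocks)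
    also have "\<dots> \<le> sum y UNIV" using y(1) by (intro sum_mono2) auto
    finally show ?thesis using y(3) by simp
  qed
  finally have "(\<Sum>K\<in>bip_blocks R C E. sqrt (block_sum E w K)) \<le> 1" by simp
  then show ?thesis
    unfolding positive_conditions_def
    using pos factorization_imp_cycle_condition[where u=x and v=y and w=w, OF w] complete by auto
qed

section \<open>From the block inequality to a completion\<close>

text \<open>
  As \<open>s\<close> grows, the left factor tends to infinity and the right one stays above \<open>c\<close>.
\<close>
lemma rescale_to_one:
  fixes a b c d :: real
  assumes "0 \<le> a" "0 < b" "0 < c" "0 \<le> d" "(a + b) * (c + d) \<le> 1"
  shows "\<exists>s>0. (a + s * b) * (c + d / s) = 1"
proof -
  \<comment> \<open>At \<open>s = M\<close> the single term \<open>s * b * c\<close> of the product is already at least one.\<close>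
  define M where "M = max 1 (1 / (b * c))"
  have M: "1 \<le> M" "1 / (b * c) \<le> M" by (auto simp: M_def)
  have "1 \<le> M * b * c" using M(2) assms by (simp add: field_simps)
  also have "\<dots> \<le> (a + M * b) * (c + d / M)"
    using M assms by (intro mult_mono) auto
  finally have top: "1 \<le> (a + M * b) * (c + d / M)" .
  have "continuous_on {1..M} (\<lambda>s. (a + s * b) * (c + d / s))"
    by (intro continuous_intros) auto
  then obtain s where "1 \<le> s" "s \<le> M" "(a + s * b) * (c + d / s) = 1"
    using IVT'[of "\<lambda>s. (a + s * b) * (c + d / s)" 1 1 M] assms(5) top M(1) by auto
  then show ?thesis by (intro exI[of _ s]) auto
qed

text \<open>
  The mass \<open>1 - \<sigma>\<close> left over by the blocks is spread over the indices outside them. Dividing by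
  \<open>card N\<close> instead of the number of these indices keeps the total at most one and needs no
  distinction of whether there are any.
\<close>
lemma sum_spread_le_one:
  fixes g :: "'a::finite \<Rightarrow> real" and \<iota> :: "'a \<Rightarrow> 'v"
  assumes F: "finite F" "disjoint F" and sub: "\<And>a. \<iota> a \<in> \<Union>F \<Longrightarrow> a \<in> N"
    and \<sigma>: "(\<Sum>K\<in>F. \<Sum>a | \<iota> a \<in> K. g a) = \<sigma>" "\<sigma> \<le> 1"
  defines "x \<equiv> \<lambda>a. if \<iota> a \<in> \<Union>F then g a else if a \<in> N then (1 - \<sigma>) / card N else 0"
  shows "sum x UNIV \<le> 1" and "\<sigma> = 1 \<Longrightarrow> sum x UNIV = 1"
proof -
  let ?B = "{a. \<iota> a \<in> \<Union>F}"
  have "sum x UNIV = sum x N"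
    using sub by (intro sum.mono_neutral_right) (auto simp: x_def)
  also have "\<dots> = sum x (N - ?B) + sum x ?B"
    using sub by (intro sum.subset_diff) auto
  also have "sum x ?B = sum g ?B"
    by (intro sum.cong) (auto simp: x_def)
  also have "sum g ?B = \<sigma>"
    using sum_over_disjoint_family[OF F, of g \<iota>] \<sigma>(1) by simp
  also have "sum x (N - ?B) = card (N - ?B) * ((1 - \<sigma>) / card N)"
    by (simp add: x_def)
  finally have eq: "sum x UNIV = card (N - ?B) * ((1 - \<sigma>) / card N) + \<sigma>" .
  have "card (N - ?B) * ((1 - \<sigma>) / card N) \<le> 1 - \<sigma>"
  proof (cases "N = {}")
    case False
    have "real (card (N - ?B)) \<le> card N" by (simp add: card_mono)
    then have "card (N - ?B) * ((1 - \<sigma>) / card N) \<le> card N * ((1 - \<sigma>) / card N)"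
      using \<sigma>(2) by (intro mult_right_mono) auto
    then show ?thesis using False by simp
  qed (use \<sigma>(2) in simp)
  then show "sum x UNIV \<le> 1" using eq by simp
  show "sum x UNIV = 1" if "\<sigma> = 1" using eq that by simp
qed

text \<open>
  Balance every block so that its row mass and its column mass are both the square root of its
  weight, and spread the remaining mass over the isolated vertices. If \<open>\<sigma> = 1\<close> the total is one.
  Otherwise all potentials are positive, and rescaling the component of a row that does not reach
  some column moves the total to one without changing any specified entry.
\<close>
lemma balanced_factorization:
  fixes R :: "'m::finite set" and C :: "'n::finite set"
  assumes E: "E \<subseteq> R \<times> C" and incomplete: "bip_closure R C E \<noteq> R \<times> C"
    and u: "\<And>i. 0 < u i" and v: "\<And>j. 0 < v j"
    and le: "(\<Sum>K\<in>bip_blocks R C E. sqrt ((\<Sum>i | Inl i \<in> K. u i) * (\<Sum>j | Inr j \<in> K. v j))) \<le> 1"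
  obtains x y where "\<forall>i. 0 \<le> x i" "\<forall>j. 0 \<le> y j" "\<forall>i. i \<notin> R \<longrightarrow> x i = 0" "\<forall>j. j \<notin> C \<longrightarrow> y j = 0"
    "\<forall>i j. (i, j) \<in> E \<longrightarrow> x i * y j = u i * v j" "sum x UNIV * sum y UNIV = (1::real)"
proof -
  let ?F = "bip_blocks R C E"
  define U where "U = (\<lambda>K :: ('m + 'n) set. \<Sum>i | Inl i \<in> K. u i)"
  define V where "V = (\<lambda>K :: ('m + 'n) set. \<Sum>j | Inr j \<in> K. v j)"
  define \<sigma> where "\<sigma> = (\<Sum>K\<in>?F. sqrt (U K * V K))"
  define blk where "blk = (\<lambda>z. THE K. K \<in> ?F \<and> z \<in> K)"
  have blk: "blk z = K" if "K \<in> ?F" "z \<in> K" for z K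
    unfolding blk_def using that disjoint_bip_blocks[of R C E]
    by (intro the_equality) (auto simp: disjoint_def)
  have UV: "0 < U K" "0 < V K" if K: "K \<in> ?F" for K
  proof -
    obtain i j where "Inl i \<in> K" "Inr j \<in> K"
      using K by (auto simp: bip_blocks_def complete_bip_edges_def)
    then show "0 < U K" "0 < V K"
      unfolding U_def V_def using u v by (auto intro!: sum_pos)
  qed
  have sub: "\<Union>?F \<subseteq> R <+> C"
    using bip_components_subset unfolding bip_blocks_def by blast
  have \<sigma>: "\<sigma> \<le> 1" using le by (simp add: \<sigma>_def U_def V_def)
  \<comment> \<open>Multiplying the rows of \<open>K\<close> by \<open>sqrt (V K / U K)\<close> and dividing its columns by the same factor
    turns the masses \<open>U K\<close> and \<open>V K\<close> into their geometric mean.\<close>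
  define g where "g = (\<lambda>i. u i * sqrt (V (blk (Inl i)) / U (blk (Inl i))))"
  define h where "h = (\<lambda>j. v j * sqrt (U (blk (Inr j)) / V (blk (Inr j))))"
  define x where "x = (\<lambda>i. if Inl i \<in> \<Union>?F then g i else if i \<in> R then (1 - \<sigma>) / card R else 0)"
  define y where "y = (\<lambda>j. if Inr j \<in> \<Union>?F then h j else if j \<in> C then (1 - \<sigma>) / card C else 0)"
  have root: "p * sqrt (q / p) = sqrt (p * q)" if "0 < p" "0 < q" for p q :: real
  proof -
    have "p * sqrt (q / p) = sqrt (p\<^sup>2 * (q / p))"
      unfolding real_sqrt_mult using that by simp
    moreover have "p\<^sup>2 * (q / p) = p * q"
      using that by (simp add: power2_eq_square)
    ultimately show ?thesis by simp
  qed
  have gK: "(\<Sum>i | Inl i \<in> K. g i) = sqrt (U K * V K)" if "K \<in> ?F" for K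
  proof -
    have "(\<Sum>i | Inl i \<in> K. g i) = (\<Sum>i | Inl i \<in> K. u i * sqrt (V K / U K))"
      using blk[OF that] by (intro sum.cong) (auto simp: g_def)
    then show ?thesis using root UV[OF that] by (simp add: U_def flip: sum_distrib_right)
  qed
  have hK: "(\<Sum>j | Inr j \<in> K. h j) = sqrt (U K * V K)" if "K \<in> ?F" for K
  proof -
    have "(\<Sum>j | Inr j \<in> K. h j) = (\<Sum>j | Inr j \<in> K. v j * sqrt (U K / V K))"
      using blk[OF that] by (intro sum.cong) (auto simp: h_def)
    then show ?thesis
      using root[of "V K" "U K"] UV[OF that] by (simp add: V_def mult.commute flip: sum_distrib_right)
  qed
  have g: "0 < g i" if "Inl i \<in> \<Union>?F" for i
    using that u UV blk by (auto simp: g_def)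
  have h: "0 < h j" if "Inr j \<in> \<Union>?F" for j
    using that v UV blk by (auto simp: h_def)
  have x0: "0 \<le> x i" and y0: "0 \<le> y j" for i j
    using \<sigma> g h by (auto simp: x_def y_def less_imp_le)
  have xR: "x i = 0" if "i \<notin> R" for i using that sub by (auto simp: x_def)
  have yC: "y j = 0" if "j \<notin> C" for j using that sub by (auto simp: y_def)
  have sum_x: "sum x UNIV \<le> 1" "\<sigma> = 1 \<Longrightarrow> sum x UNIV = 1"
    unfolding x_def using sub \<sigma>
    by (intro sum_spread_le_one; auto simp: disjoint_bip_blocks gK \<sigma>_def)+
  have sum_y: "sum y UNIV \<le> 1" "\<sigma> = 1 \<Longrightarrow> sum y UNIV = 1"
    unfolding y_def using sub \<sigma>
    by (intro sum_spread_le_one; auto simp: disjoint_bip_blocks hK \<sigma>_def)+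
  have xy: "x i * y j = u i * v j" if ij: "(i, j) \<in> E" for i j
  proof -
    obtain K where K: "K \<in> ?F" "Inl i \<in> K" "Inr j \<in> K"
      using edge_in_bip_block[OF E ij] by blast
    have "x i * y j = u i * v j * (sqrt (V K / U K) * sqrt (U K / V K))"
      using K blk[OF K(1)] by (auto simp: x_def y_def g_def h_def)
    also have "sqrt (V K / U K) * sqrt (U K / V K) = 1"
      using UV[OF K(1)] by (simp flip: real_sqrt_mult)
    finally show ?thesis by simp
  qed
  show thesis
  proof (cases "\<sigma> = 1")
    case True
    then show thesis
      by (intro that[of x y]) (use x0 y0 xR yC xy sum_x(2) sum_y(2) in auto)
  next
    case False
    have xpos: "0 < x i" if "i \<in> R" for i
    proof -
      have "0 < card R" using that by (auto simp: card_gt_0_iff)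
      then show ?thesis using that False \<sigma> g by (auto simp: x_def)
    qed
    have ypos: "0 < y j" if "j \<in> C" for j
    proof -
      have "0 < card C" using that by (auto simp: card_gt_0_iff)
      then show ?thesis using that False \<sigma> h by (auto simp: y_def)
    qed
    obtain i0 j0 where ij: "i0 \<in> R" "j0 \<in> C" "(Inl i0, Inr j0) \<notin> (bip_adj E)\<^sup>*"
      using incomplete by (auto simp: bip_closure_iff set_eq_iff)
    define D where "D = (bip_adj E)\<^sup>* `` {Inl i0}"
    have D_edge: "Inl a \<in> D \<longleftrightarrow> Inr b \<in> D" if "(a, b) \<in> E" for a b
    proof -
      have "(Inl a, Inr b) \<in> bip_adj E" "(Inr b, Inl a) \<in> bip_adj E"
        using that by (auto simp: bip_adj_def)
      then show ?thesis unfolding D_def by (auto intro: rtrancl_into_rtrancl)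
    qed
    \<comment> \<open>Multiplying the rows of \<open>D\<close> by \<open>s\<close> and dividing its columns by \<open>s\<close> changes the total to
      \<open>(a + s * b) * (c + d / s)\<close>; row \<open>i0\<close> makes \<open>b\<close> and column \<open>j0\<close> makes \<open>c\<close> positive.\<close>
    define a where "a = (\<Sum>i | Inl i \<notin> D. x i)"
    define b where "b = (\<Sum>i | Inl i \<in> D. x i)"
    define c where "c = (\<Sum>j | Inr j \<notin> D. y j)"
    define d where "d = (\<Sum>j | Inr j \<in> D. y j)"
    have split_x: "(\<Sum>i\<in>UNIV. if Inl i \<in> D then s * x i else x i) = a + s * b" for s
      by (simp add: sum.If_cases a_def b_def sum_distrib_left Collect_neg_eq)
    have split_y: "(\<Sum>j\<in>UNIV. if Inr j \<in> D then y j / s else y j) = c + d / s" for s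
      by (simp add: sum.If_cases c_def d_def sum_divide_distrib Collect_neg_eq)
    have "0 \<le> a" "0 \<le> d" by (auto simp: a_def d_def x0 y0 intro: sum_nonneg)
    moreover have "0 < b"
      unfolding b_def using ij x0 xpos by (intro sum_pos2[of _ i0]) (auto simp: D_def)
    moreover have "0 < c"
      unfolding c_def using ij y0 ypos by (intro sum_pos2[of _ j0]) (auto simp: D_def)
    moreover have "(a + b) * (c + d) \<le> 1"
    proof (rule mult_le_one)
      show "a + b \<le> 1" "c + d \<le> 1"
        using split_x[of 1] split_y[of 1] sum_x(1) sum_y(1) by (simp_all cong: if_cong)
      show "0 \<le> c + d" using \<open>0 < c\<close> \<open>0 \<le> d\<close> by simp
    qed
    ultimately obtain s where s: "0 < s" "(a + s * b) * (c + d / s) = 1"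
      using rescale_to_one by metis
    show thesis
    proof (rule that[of "\<lambda>i. if Inl i \<in> D then s * x i else x i"
          "\<lambda>j. if Inr j \<in> D then y j / s else y j"])
      show "\<forall>i j. (i, j) \<in> E \<longrightarrow>
          (if Inl i \<in> D then s * x i else x i) * (if Inr j \<in> D then y j / s else y j) = u i * v j"
        using D_edge xy s(1) by auto
    qed (use s x0 y0 xR yC in \<open>auto simp: split_x split_y\<close>)
  qed
qed

lemma positive_conditions_imp_factorization:
  fixes R :: "'m::finite set" and C :: "'n::finite set"
  assumes E: "E \<subseteq> R \<times> C" and R: "R \<noteq> {}" "C \<noteq> {}" and cond: "positive_conditions R C E w"
  obtains x y where "\<forall>i. 0 \<le> x i" "\<forall>j. 0 \<le> y j" "\<forall>i. i \<notin> R \<longrightarrow> x i = 0" "\<forall>j. j \<notin> C \<longrightarrow> y j = 0"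
    "\<forall>i j. (i, j) \<in> E \<longrightarrow> x i * y j = w (i, j)" "sum x UNIV * sum y UNIV = (1::real)"
proof -
  have pos: "\<And>e. e \<in> E \<Longrightarrow> 0 < w e" and cyc: "cycle_condition E w"
    using cond by (auto simp: positive_conditions_def)
  obtain u v where u: "\<And>i. 0 < u i" and v: "\<And>j. 0 < v j"
    and w: "\<And>i j. (i, j) \<in> E \<Longrightarrow> w (i, j) = u i * v j"
    using cycle_condition_imp_factorization[OF finite pos cyc] by metis
  have b: "block_sum E w K = (\<Sum>i | Inl i \<in> K. u i) * (\<Sum>j | Inr j \<in> K. v j)"
    if "K \<in> bip_blocks R C E" for K
    using pos that w by (intro block_sum_eq) (auto simp: less_le)
  show thesis
  proof (cases "bip_closure R C E = R \<times> C")
    case True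
    have blocks: "bip_blocks R C E = {R <+> C}"
      by (rule complete_closure_blocks[OF E R True])
    moreover have "{i. Inl i \<in> R <+> C} = R" "{j. Inr j \<in> R <+> C} = C" by auto
    ultimately have one: "sum u R * sum v C = 1"
      using cond True b[of "R <+> C"] by (auto simp: positive_conditions_def)
    show thesis
    proof (rule that[of "\<lambda>i. if i \<in> R then u i else 0" "\<lambda>j. if j \<in> C then v j else 0"])
      show "(\<Sum>i\<in>UNIV. if i \<in> R then u i else 0) * (\<Sum>j\<in>UNIV. if j \<in> C then v j else 0) = 1"
        using one by (simp flip: sum.inter_filter add: sum.If_cases)
    qed (use u v w E in \<open>auto simp: less_imp_le\<close>)
  next
    case False
    then have "(\<Sum>K\<in>bip_blocks R C E.
        sqrt ((\<Sum>i | Inl i \<in> K. u i) * (\<Sum>j | Inr j \<in> K. v j))) \<le> 1"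
      using cond b by (simp add: positive_conditions_def)
    then obtain x y where x: "\<forall>i. 0 \<le> x i" and y: "\<forall>j. 0 \<le> y j"
      and x0: "\<forall>i. i \<notin> R \<longrightarrow> x i = 0" and y0: "\<forall>j. j \<notin> C \<longrightarrow> y j = 0"
      and xy: "\<forall>i j. (i, j) \<in> E \<longrightarrow> x i * y j = u i * v j" and total: "sum x UNIV * sum y UNIV = 1"
      by (rule balanced_factorization[where u=u and v=v, OF E False u v])
    have "\<forall>i j. (i, j) \<in> E \<longrightarrow> x i * y j = w (i, j)" using xy w by simp
    from that[OF x y x0 y0 this total] show thesis .
  qed
qed

section \<open>The completable partial matrices\<close>

theorem theorem2p18:
  fixes S :: "('m::finite \<times> 'n::finite) set"
  shows "{w \<in> extensional S.
            \<exists>A :: real ^ 'n ^ 'm. A \<in> simplex_matrices \<and> rank A = 1 \<and> is_completion S w A} =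
         (\<Union>I\<in>{I. I \<subset> UNIV}. \<Union>J\<in>{J. J \<subset> UNIV}. X_set I J S)"
proof (intro equalityI subsetI)
  fix w assume "w \<in> {w \<in> extensional S.
    \<exists>A :: real ^ 'n ^ 'm. A \<in> simplex_matrices \<and> rank A = 1 \<and> is_completion S w A}"
  then obtain A :: "real ^ 'n ^ 'm" where ext: "w \<in> extensional S"
    and A: "A \<in> simplex_matrices" "rank A = 1" "is_completion S w A" by auto
  obtain x y where x: "\<forall>i. 0 \<le> x i" and y: "\<forall>j. 0 \<le> y j"
    and sums: "sum x UNIV = 1" "sum y UNIV = 1" and xy: "\<forall>i j. A $ i $ j = x i * y j"
    by (rule rank_one_simplex_factors[OF A(1,2)])
  have w: "w (i, j) = x i * y j" if "(i, j) \<in> S" for i j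
    using A(3) that xy by (auto simp: is_completion_def)
  define I where "I = {i. x i = 0}"
  define J where "J = {j. y j = 0}"
  have I: "I \<noteq> UNIV"
  proof
    assume "I = UNIV"
    then have "sum x UNIV = 0" by (intro sum.neutral) (auto simp: I_def)
    then show False using sums by simp
  qed
  have J: "J \<noteq> UNIV"
  proof
    assume "J = UNIV"
    then have "sum y UNIV = 0" by (intro sum.neutral) (auto simp: J_def)
    then show False using sums by simp
  qed
  let ?E = "S \<inter> ((- I) \<times> (- J))"
  have "positive_conditions (- I) (- J) ?E (restrict w ?E)"
    by (rule factorization_imp_positive_conditions[of _ _ _ x y])
      (use I J x y sums w in \<open>auto simp: I_def J_def less_le\<close>)
  then have "w \<in> X_set I J S"
    using ext w by (auto simp: X_set_def Let_def I_def J_def)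
  then show "w \<in> (\<Union>I\<in>{I. I \<subset> UNIV}. \<Union>J\<in>{J. J \<subset> UNIV}. X_set I J S)"
    using I J by blast
next
  fix w assume "w \<in> (\<Union>I\<in>{I. I \<subset> UNIV}. \<Union>J\<in>{J. J \<subset> UNIV}. X_set I J S)"
  then obtain I J where IJ: "- I \<noteq> {}" "- J \<noteq> {}" and w: "w \<in> X_set I J S" by auto
  let ?E = "S \<inter> ((- I) \<times> (- J))"
  have ext: "w \<in> extensional S"
    and zero: "\<And>i j. (i, j) \<in> S \<Longrightarrow> w (i, j) = 0 \<longleftrightarrow> i \<in> I \<or> j \<in> J"
    and cond: "positive_conditions (- I) (- J) ?E (restrict w ?E)"
    using w by (auto simp: X_set_def Let_def)
  obtain x y where x: "\<forall>i. 0 \<le> x i" and y: "\<forall>j. 0 \<le> y j"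
    and x0: "\<forall>i. i \<notin> - I \<longrightarrow> x i = 0" and y0: "\<forall>j. j \<notin> - J \<longrightarrow> y j = 0"
    and xy: "\<forall>i j. (i, j) \<in> ?E \<longrightarrow> x i * y j = restrict w ?E (i, j)"
    and total: "sum x UNIV * sum y UNIV = 1"
    by (rule positive_conditions_imp_factorization[OF Int_lower2 IJ cond])
  have "x i * y j = w (i, j)" if "(i, j) \<in> S" for i j
  proof (cases "i \<in> I \<or> j \<in> J")
    case True
    then show ?thesis using zero[OF that] x0 y0 by auto
  next
    case False
    then show ?thesis using xy that by simp
  qed
  then have completion: "is_completion S w (\<chi> i j. x i * y j)"
    by (auto simp: is_completion_def)
  have nonneg: "\<And>i. 0 \<le> x i" "\<And>j. 0 \<le> y j" using x y by auto
  show "w \<in> {w \<in> extensional S.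
    \<exists>A :: real ^ 'n ^ 'm. A \<in> simplex_matrices \<and> rank A = 1 \<and> is_completion S w A}"
    by (intro CollectI conjI exI[of _ "\<chi> i j. x i * y j"] ext completion outer_product_rank_one_simplex[OF nonneg total])
qed

end
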